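(* Let $X_1,\ldots,X_n$ be independent random variables with values in a Polish space $\mathcal{X}$, and let $\mathcal{S}$ be a nonempty countable class of measurable functions $s=(s^1,\ldots,s^n)$ from $\mathcal{X}$ into $[-1,1]^n$. Suppose that $\mathbb{E}(s^k(X_k))=0$ for any $s\in\mathcal{S}$ and any integer $k\in[1,n]$. Let $S_n(s)=s^1(X_1)+\cdots+s^n(X_n)$, $Z=\sup\{S_n(s):s\in\mathcal{S}\}$ and $V_n=\sup_{s\in\mathcal{S}}\operatorname{Var}S_n(s)$. Then $$\operatorname{Var}Z\le V_n+2\,\mathbb{E}(Z).$$
   Context: Each component $s^k$ is a measurable function from $\mathcal{X}$ into $[-1,1]$. The variables $X_k$ need not be identically distributed. *)

theory Defs
  imports "HOL-Probability.Probability"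
begin

text \<open>
  A class element \<open>s = (s\<^sup>1, \<dots>, s\<^sup>n)\<close> is a function \<open>s :: nat \<Rightarrow> 'x \<Rightarrow> real\<close>, of which only
  the components \<open>s k\<close> with \<open>1 \<le> k \<le> n\<close> matter. When these components take values in
  \<open>[-1,1]\<close> and the class is nonempty, the real suprema below are over nonempty
  sets bounded above, hence genuine.
\<close>

definition class_sum ::
  "nat \<Rightarrow> (nat \<Rightarrow> 'w \<Rightarrow> 'x) \<Rightarrow> (nat \<Rightarrow> 'x \<Rightarrow> real) \<Rightarrow> 'w \<Rightarrow> real" where
  "class_sum n X s \<omega> = (\<Sum>k = 1..n. s k (X k \<omega>))"

definition class_sup ::
  "nat \<Rightarrow> (nat \<Rightarrow> 'w \<Rightarrow> 'x) \<Rightarrow> (nat \<Rightarrow> 'x \<Rightarrow> real) set \<Rightarrow> 'w \<Rightarrow> real" where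
  "class_sup n X S \<omega> = (SUP s\<in>S. class_sum n X s \<omega>)"

definition class_var ::
  "'w measure \<Rightarrow> nat \<Rightarrow> (nat \<Rightarrow> 'w \<Rightarrow> 'x) \<Rightarrow> (nat \<Rightarrow> 'x \<Rightarrow> real) set \<Rightarrow> real" where
  "class_var M n X S = (SUP s\<in>S. prob_space.variance M (class_sum n X s))"

end

theory Submission
  imports Defs
begin

text \<open>
  By the Efron-Stein inequality it suffices to bound, for each \<open>k\<close>, the variance of \<open>Z\<close> with
  respect to the coordinate \<open>X\<^sub>k\<close> alone. Let \<open>\<tau>\<close> be the index of an \<open>\<epsilon>\<close>-maximiser of \<open>Z\<close>. Comparing
  \<open>Z\<close> with the supremum that omits \<open>X\<^sub>k\<close> would produce a sum of suprema of variances, which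
  may exceed \<open>V\<^sub>n\<close> when the variables are not identically distributed. Instead \<open>Z\<close> is compared with
  the sums omitting \<open>X\<^sub>k\<close>, averaged over the conditional law of \<open>\<tau>\<close> given the other variables;
  call this average \<open>W\<close>. Then \<open>Z - W\<close> dominates a centred variable \<open>Q\<close>, the corresponding average
  of the \<open>s\<^sup>k(X\<^sub>k)\<close>, and with \<open>m = E\<^sub>k(Z) - W\<close> one has \<open>Z - W \<le> m + 1 + \<epsilon>\<close> and \<open>Q \<le> 1\<close>. Hence
  \<open>Var\<^sub>k(Z) = E\<^sub>k((Z - W)\<^sup>2) - m\<^sup>2 \<le> E\<^sub>k(Q\<^sup>2) + (2 + m + \<epsilon>) m - m\<^sup>2 = E\<^sub>k(Q\<^sup>2) + (2 + \<epsilon>) m\<close>.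
  Summed over \<open>k\<close>, the first terms average \<open>Var S\<^sub>n(s)\<close> over the law of \<open>\<tau>\<close> and the \<open>m\<close>'s add
  up to at most \<open>E(Z) + n \<epsilon>\<close>; finally \<open>\<epsilon>\<close> tends to \<open>0\<close>.
\<close>

section \<open>Means and variances of bounded functions on product spaces\<close>

lemma (in prob_space) abs_expectation_le:
  fixes f :: "'a \<Rightarrow> real"
  assumes B: "\<And>x. \<bar>f x\<bar> \<le> B"
  shows "\<bar>expectation f\<bar> \<le> B"
proof (cases "integrable M f")
  case True
  have "\<bar>expectation f\<bar> \<le> expectation (\<lambda>x. \<bar>f x\<bar>)" by (rule integral_abs_bound)
  also have "\<dots> \<le> expectation (\<lambda>x. B)" by (rule integral_mono) (use True B in auto)
  finally show ?thesis by (simp add: prob_space)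
next
  \<comment> \<open>The Bochner integral of a non-integrable function is 0, and \<open>B\<close> is
    nonnegative because it bounds an absolute value.\<close>
  case False
  then show ?thesis using B[of undefined] by (simp add: not_integrable_integral_eq)
qed

lemma (in prob_space) abs_variance_le:
  fixes f :: "'a \<Rightarrow> real"
  assumes B: "\<And>x. \<bar>f x\<bar> \<le> B"
  shows "\<bar>variance f\<bar> \<le> (2 * B)\<^sup>2"
proof (rule abs_expectation_le)
  fix x
  have "\<bar>f x - expectation f\<bar> \<le> 2 * B"
    using B[of x] abs_expectation_le[of f B, OF B] by linarith
  then have "\<bar>f x - expectation f\<bar>\<^sup>2 \<le> (2 * B)\<^sup>2" by (rule power_mono) simp
  then show "\<bar>(f x - expectation f)\<^sup>2\<bar> \<le> (2 * B)\<^sup>2" by simp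
qed

lemma (in pair_prob_space) bounded_integrals:
  fixes h :: "'a \<times> 'b \<Rightarrow> real"
  assumes h [measurable]: "h \<in> borel_measurable (M1 \<Otimes>\<^sub>M M2)" and B: "\<And>z. \<bar>h z\<bar> \<le> B"
  shows "integrable (M1 \<Otimes>\<^sub>M M2) h"
    and "integrable (M1 \<Otimes>\<^sub>M M2) (\<lambda>z. (h z)\<^sup>2)"
    and "x \<in> space M1 \<Longrightarrow> integrable M2 (\<lambda>y. h (x, y))"
    and "x \<in> space M1 \<Longrightarrow> integrable M2 (\<lambda>y. (h (x, y))\<^sup>2)"
    and "integrable M1 (\<lambda>x. \<integral>y. h (x, y) \<partial>M2)"
    and "integrable M1 (\<lambda>x. (\<integral>y. h (x, y) \<partial>M2)\<^sup>2)"
    and "\<bar>\<integral>y. h (x, y) \<partial>M2\<bar> \<le> B"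
proof -
  have sq: "(h z)\<^sup>2 \<le> B\<^sup>2" for z
    using B[of z] power_mono[of "\<bar>h z\<bar>" B 2] by simp
  show "integrable (M1 \<Otimes>\<^sub>M M2) h"
    by (rule P.integrable_const_bound[where B=B]) (use B in auto)
  show "integrable (M1 \<Otimes>\<^sub>M M2) (\<lambda>z. (h z)\<^sup>2)"
    by (rule P.integrable_const_bound[where B="B\<^sup>2"]) (use sq in auto)
  show "x \<in> space M1 \<Longrightarrow> integrable M2 (\<lambda>y. h (x, y))"
    by (rule M2.integrable_const_bound[where B=B]) (use B in auto)
  show "x \<in> space M1 \<Longrightarrow> integrable M2 (\<lambda>y. (h (x, y))\<^sup>2)"
    by (rule M2.integrable_const_bound[where B="B\<^sup>2"]) (use sq in auto)
  have ab: "\<bar>\<integral>y. h (x, y) \<partial>M2\<bar> \<le> B" for x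
    by (rule M2.abs_expectation_le) (rule B)
  then show "\<bar>\<integral>y. h (x, y) \<partial>M2\<bar> \<le> B" .
  show "integrable M1 (\<lambda>x. \<integral>y. h (x, y) \<partial>M2)"
    by (rule M1.integrable_const_bound[where B=B]) (use ab in auto)
  show "integrable M1 (\<lambda>x. (\<integral>y. h (x, y) \<partial>M2)\<^sup>2)"
    by (rule M1.integrable_const_bound[where B="B\<^sup>2"])
       (use power_mono[OF ab, where n=2] in auto)
qed

lemma (in prob_space) square_integral_le:
  fixes f :: "'a \<Rightarrow> real"
  assumes "integrable M f" "integrable M (\<lambda>x. (f x)\<^sup>2)"
  shows "(\<integral>x. f x \<partial>M)\<^sup>2 \<le> (\<integral>x. (f x)\<^sup>2 \<partial>M)"
  using variance_eq[OF assms] variance_positive[of f] by linarith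

text \<open>Law of total variance: writing each variance as second moment minus squared mean, the
  mean of the squared conditional expectation occurs on the right with both signs and
  cancels.\<close>

lemma (in pair_prob_space) total_variance:
  fixes h :: "'a \<times> 'b \<Rightarrow> real"
  assumes h [measurable]: "h \<in> borel_measurable (M1 \<Otimes>\<^sub>M M2)" and B: "\<And>z. \<bar>h z\<bar> \<le> B"
  shows "P.variance h = M1.expectation (\<lambda>x. M2.variance (\<lambda>y. h (x, y)))
           + M1.variance (\<lambda>x. M2.expectation (\<lambda>y. h (x, y)))"
proof -
  note I = bounded_integrals[OF h B]
  have P: "P.variance h = P.expectation (\<lambda>z. (h z)\<^sup>2) - (P.expectation h)\<^sup>2"
    by (rule P.variance_eq) (rule I)+
  have P1: "P.expectation (\<lambda>z. (h z)\<^sup>2) = M1.expectation (\<lambda>x. M2.expectation (\<lambda>y. (h (x, y))\<^sup>2))"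
    using integral_fst'[OF I(2)] by simp
  have P2: "P.expectation h = M1.expectation (\<lambda>x. M2.expectation (\<lambda>y. h (x, y)))"
    using integral_fst'[OF I(1)] by simp
  have "M1.expectation (\<lambda>x. M2.variance (\<lambda>y. h (x, y)))
     = M1.expectation (\<lambda>x. M2.expectation (\<lambda>y. (h (x, y))\<^sup>2) - (M2.expectation (\<lambda>y. h (x, y)))\<^sup>2)"
    by (intro Bochner_Integration.integral_cong refl M2.variance_eq I)
  also have "\<dots> = M1.expectation (\<lambda>x. M2.expectation (\<lambda>y. (h (x, y))\<^sup>2))
     - M1.expectation (\<lambda>x. (M2.expectation (\<lambda>y. h (x, y)))\<^sup>2)"
    by (intro Bochner_Integration.integral_diff I integrable_fst')
  finally show ?thesis
    unfolding P unfolding P1 P2 using M1.variance_eq[OF I(5,6)] by simp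
qed

text \<open>Convexity of the variance. Once \<open>h\<close> is centred in its first argument, the
  left side is the mean square of an average over the second argument; Jensen moves the square
  inside this average and Fubini swaps the integrals.\<close>

lemma (in pair_prob_space) variance_expectation_le:
  fixes h :: "'a \<times> 'b \<Rightarrow> real"
  assumes h [measurable]: "h \<in> borel_measurable (M1 \<Otimes>\<^sub>M M2)" and B: "\<And>z. \<bar>h z\<bar> \<le> B"
  shows "M1.variance (\<lambda>x. M2.expectation (\<lambda>y. h (x, y)))
           \<le> M2.expectation (\<lambda>y. M1.variance (\<lambda>x. h (x, y)))"
proof -
  interpret Q: pair_prob_space M2 M1 ..
  note I = bounded_integrals[OF h B]
  have "(\<lambda>z. h (snd z, fst z)) \<in> borel_measurable (M2 \<Otimes>\<^sub>M M1)" by measurable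
  note J = Q.bounded_integrals[OF this B, simplified]
  define D where "D z = h z - M1.expectation (\<lambda>x. h (x, snd z))" for z
  have D: "D \<in> borel_measurable (M1 \<Otimes>\<^sub>M M2)"
    unfolding D_def by measurable
  have BD: "\<bar>D z\<bar> \<le> 2 * B" for z
    using B[of z] J(7)[of "snd z"] unfolding D_def by linarith
  note K = bounded_integrals[OF D BD]
  have swap: "M1.expectation (\<lambda>x. M2.expectation (\<lambda>y. h (x, y)))
    = M2.expectation (\<lambda>y. M1.expectation (\<lambda>x. h (x, y)))"
    using Fubini_integral[of "\<lambda>x y. h (x, y)", symmetric] I(1) by simp
  have "M1.variance (\<lambda>x. M2.expectation (\<lambda>y. h (x, y)))
      = M1.expectation (\<lambda>x. (M2.expectation (\<lambda>y. D (x, y)))\<^sup>2)"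
    unfolding swap D_def
    by (intro Bochner_Integration.integral_cong refl)
       (simp add: Bochner_Integration.integral_diff[OF I(3) J(5)])
  also have "\<dots> \<le> M1.expectation (\<lambda>x. M2.expectation (\<lambda>y. (D (x, y))\<^sup>2))"
    by (intro integral_mono K M2.square_integral_le integrable_fst')
  also have "\<dots> = M2.expectation (\<lambda>y. M1.expectation (\<lambda>x. (D (x, y))\<^sup>2))"
    using Fubini_integral[of "\<lambda>x y. (D (x, y))\<^sup>2", symmetric] K(2) by (simp add: case_prod_unfold)
  finally show ?thesis by (simp add: D_def)
qed

section \<open>Variance of the supremum in a single coordinate\<close>

lemma (in prob_space) variance_selection_le:
  fixes a :: "nat \<Rightarrow> real" and b :: "nat \<Rightarrow> 'a \<Rightarrow> real" and f :: "'a \<Rightarrow> real"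
  assumes b [measurable]: "\<And>j. b j \<in> borel_measurable M"
    and f [measurable]: "f \<in> borel_measurable M"
    and T [measurable]: "T \<in> M \<rightarrow>\<^sub>M count_space UNIV"
    and b1: "\<And>j y. \<bar>b j y\<bar> \<le> 1" and b0: "\<And>j. expectation (b j) = 0"
    and a: "\<And>j. \<bar>a j\<bar> \<le> A"
    and ub: "\<And>j y. a j + b j y \<le> f y"
    and sel: "\<And>y. f y \<le> a (T y) + b (T y) y + \<epsilon>"
  shows "variance f \<le> expectation (\<lambda>y. expectation (\<lambda>x. (b (T y) x)\<^sup>2))
           + (2 + \<epsilon>) * (expectation f - expectation (\<lambda>y. a (T y)))"
proof -
  interpret P: pair_prob_space M M ..
  define W where "W = expectation (\<lambda>y. a (T y))"
  define m where "m = expectation f - W"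
  define Q where "Q x = expectation (\<lambda>y. b (T y) x)" for x
  \<comment> \<open>The second entry only selects the index, the first is an independent point of
    evaluation. This decoupling makes \<open>Q\<close> centred although \<open>b (T y) y\<close>
    need not be.\<close>
  define h where "h z = b (T (snd z)) (fst z)" for z
  have h [measurable]: "h \<in> borel_measurable (M \<Otimes>\<^sub>M M)"
    unfolding h_def by measurable
  have hB: "\<bar>h z\<bar> \<le> 1" for z unfolding h_def by (rule b1)
  note I = P.bounded_integrals[OF h hB]
  have [measurable]: "Q \<in> borel_measurable M"
    using I(5) by (simp add: h_def Q_def[abs_def] borel_measurable_integrable)
  have fb: "\<bar>f y\<bar> \<le> A + 1 + \<bar>\<epsilon>\<bar>" for y
    using a[of 0] b1[of 0 y] ub[of 0 y] a[of "T y"] b1[of "T y" y] sel[of y] by linarith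
  have fi: "integrable M f"
    by (rule integrable_const_bound[where B="A + 1 + \<bar>\<epsilon>\<bar>"]) (use fb in auto)
  have ai: "integrable M (\<lambda>y. a (T y))"
    by (rule integrable_const_bound[where B=A]) (use a in auto)
  have bi: "integrable M (b j)" for j
    by (rule integrable_const_bound[where B=1]) (use b1 in auto)
  have Qi: "integrable M Q" "integrable M (\<lambda>x. (Q x)\<^sup>2)"
    using I(5,6) by (simp_all add: h_def Q_def[abs_def])
  have Q1: "\<bar>Q x\<bar> \<le> 1" for x using I(7) by (simp add: h_def Q_def)
  have EQ: "expectation Q = 0"
    using P.Fubini_integral[of "\<lambda>x y. h (x, y)"] I(1) b0 by (simp add: h_def Q_def[abs_def] case_prod_unfold)
  have a_le: "a j \<le> expectation f" for j
  proof -
    have "expectation (\<lambda>y. a j + b j y) \<le> expectation f"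
      by (rule integral_mono) (use bi fi ub in auto)
    then show ?thesis using bi b0 by (simp add: prob_space)
  qed
  \<comment> \<open>Every \<open>a j\<close> lies below the mean of \<open>f\<close>, in particular
    the one selected at \<open>y\<close>; the 1 bounds the free component and
    \<open>\<epsilon>\<close> is the selection error.\<close>
  have f_le: "f y \<le> expectation f + 1 + \<epsilon>" for y
    using sel[of y] a_le[of "T y"] b1[of "T y" y] by linarith
  have Q_le: "Q x \<le> f x - W" if "x \<in> space M" for x
  proof -
    have bTi: "integrable M (\<lambda>y. b (T y) x)"
      using I(3)[OF that] by (simp add: h_def)
    have "expectation (\<lambda>y. a (T y) + b (T y) x) \<le> expectation (\<lambda>y. f x)"
      by (rule integral_mono) (use ai bTi ub in auto)
    then show ?thesis using ai bTi by (simp add: Q_def W_def prob_space)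
  qed
  have m0: "0 \<le> m"
  proof -
    have "expectation Q \<le> expectation (\<lambda>x. f x - W)"
      by (rule integral_mono) (use Qi fi Q_le in auto)
    then show ?thesis using fi EQ by (simp add: m_def prob_space)
  qed
  have f2i: "integrable M (\<lambda>x. (f x - W)\<^sup>2)"
  proof -
    have "\<bar>f x - W\<bar> \<le> A + 1 + \<bar>\<epsilon>\<bar> + \<bar>W\<bar>" for x using fb[of x] by linarith
    then have "(f x - W)\<^sup>2 \<le> (A + 1 + \<bar>\<epsilon>\<bar> + \<bar>W\<bar>)\<^sup>2" for x
      by (metis abs_ge_zero power2_abs power_mono)
    then show ?thesis
      by (intro integrable_const_bound[where B="(A + 1 + \<bar>\<epsilon>\<bar> + \<bar>W\<bar>)\<^sup>2"]) auto
  qed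
  have "variance f = expectation (\<lambda>x. (f x - W)\<^sup>2) - m\<^sup>2"
  proof -
    have "variance f = variance (\<lambda>x. f x - W)"
      using fi by (simp add: prob_space)
    also have "\<dots> = expectation (\<lambda>x. (f x - W)\<^sup>2) - (expectation (\<lambda>x. f x - W))\<^sup>2"
      by (rule variance_eq) (use fi f2i in auto)
    finally show ?thesis using fi by (simp add: m_def prob_space)
  qed
  \<comment> \<open>Factor \<open>(f x - W)\<^sup>2 - (Q x)\<^sup>2\<close> as a difference of
    squares: \<open>f x - W - Q x\<close> is nonnegative, and \<open>f x - W + Q x\<close> is at
    most \<open>(m + 1 + \<epsilon>) + 1\<close>. Since \<open>Q\<close> is centred, the first
    factor has mean \<open>m\<close>.\<close>
  also have "expectation (\<lambda>x. (f x - W)\<^sup>2)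
    \<le> expectation (\<lambda>x. (Q x)\<^sup>2 + (2 + m + \<epsilon>) * (f x - W - Q x))"
  proof (rule integral_mono)
    fix x assume x: "x \<in> space M"
    have "(f x - W - Q x) * (f x - W + Q x) \<le> (f x - W - Q x) * (2 + m + \<epsilon>)"
      using Q_le[OF x] f_le[of x] Q1[of x] by (intro mult_left_mono) (auto simp: m_def)
    then show "(f x - W)\<^sup>2 \<le> (Q x)\<^sup>2 + (2 + m + \<epsilon>) * (f x - W - Q x)"
      by (simp add: algebra_simps power2_eq_square)
  qed (use f2i fi Qi in auto)
  also have "\<dots> = expectation (\<lambda>x. (Q x)\<^sup>2) + (2 + m + \<epsilon>) * m"
    using Qi fi EQ by (simp add: m_def prob_space)
  also have "expectation (\<lambda>x. (Q x)\<^sup>2) \<le> expectation (\<lambda>x. expectation (\<lambda>y. (b (T y) x)\<^sup>2))"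
  proof (rule integral_mono)
    show "integrable M (\<lambda>x. expectation (\<lambda>y. (b (T y) x)\<^sup>2))"
      using P.integrable_fst'[OF I(2)] by (simp add: h_def)
    fix x assume x: "x \<in> space M"
    show "(Q x)\<^sup>2 \<le> expectation (\<lambda>y. (b (T y) x)\<^sup>2)"
      unfolding Q_def by (rule square_integral_le) (use I(3,4)[OF x] in \<open>simp_all add: h_def\<close>)
  qed (rule Qi)
  also have "expectation (\<lambda>x. expectation (\<lambda>y. (b (T y) x)\<^sup>2))
    = expectation (\<lambda>y. expectation (\<lambda>x. (b (T y) x)\<^sup>2))"
    using P.Fubini_integral[of "\<lambda>x y. (h (x, y))\<^sup>2", symmetric] I(2) by (simp add: h_def case_prod_unfold)
  finally show ?thesis
    by (simp add: m_def W_def power2_eq_square algebra_simps)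
qed

section \<open>Resampling one coordinate, and the Efron-Stein inequality\<close>

lemma measurable_extend:
  "(\<lambda>z. (fst z)(k := snd z)) \<in> PiM I M \<Otimes>\<^sub>M M k \<rightarrow>\<^sub>M PiM (insert k I) M"
  using measurable_add_dim[of k I M] by (simp add: case_prod_unfold)

lemma measurable_resample:
  assumes "k \<in> I"
  shows "(\<lambda>z. (fst z)(k := snd z)) \<in> PiM I M \<Otimes>\<^sub>M M k \<rightarrow>\<^sub>M PiM I M"
  using measurable_extend[of k I M] assms by (simp add: insert_absorb)

lemma measurable_resample_component:
  assumes "k \<in> I" "x \<in> space (PiM I M)"
  shows "(\<lambda>y. x(k := y)) \<in> M k \<rightarrow>\<^sub>M PiM I M"
  using measurable_compose[OF measurable_Pair1'[OF assms(2)] measurable_resample[OF assms(1), of M]]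
  by simp

lemma (in finite_product_prob_space) integral_resample:
  fixes f :: "('a \<Rightarrow> 'b) \<Rightarrow> real"
  assumes k: "k \<in> I" and f: "f \<in> borel_measurable (PiM I M)" and B: "\<And>x. \<bar>f x\<bar> \<le> B"
  shows "integrable (PiM I M) (\<lambda>x. \<integral>y. f (x(k := y)) \<partial>M k)"
    and "(\<integral>x. \<integral>y. f (x(k := y)) \<partial>M k \<partial>PiM I M) = (\<integral>x. f x \<partial>PiM I M)"
proof -
  interpret R: pair_prob_space "PiM I M" "M k" ..
  have h: "(\<lambda>z. f ((fst z)(k := snd z))) \<in> borel_measurable (PiM I M \<Otimes>\<^sub>M M k)"
    by (rule measurable_compose[OF measurable_resample[OF k] f])
  show F: "integrable (PiM I M) (\<lambda>x. \<integral>y. f (x(k := y)) \<partial>M k)"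
    using R.bounded_integrals(5)[OF h B] by simp
  define J where "J = I - {k}"
  have J: "finite J" "k \<notin> J" "I = insert k J"
    using k finite_index by (auto simp: J_def)
  have fi: "integrable (PiM I M) f"
    by (rule integrable_const_bound[where B=B]) (use B f in auto)
  have "(\<integral>x. \<integral>y. f (x(k := y)) \<partial>M k \<partial>PiM I M)
      = (\<integral>x. \<integral>z. \<integral>y. f ((x(k := z))(k := y)) \<partial>M k \<partial>M k \<partial>PiM J M)"
    using F unfolding J(3) by (rule product_integral_insert[OF J(1,2)])
  \<comment> \<open>The second update erases \<open>z\<close>, so the integral over \<open>z\<close>
    is that of a constant against a probability measure.\<close>
  also have "\<dots> = (\<integral>x. \<integral>y. f (x(k := y)) \<partial>M k \<partial>PiM J M)"
    by (simp add: M.prob_space)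
  also have "\<dots> = (\<integral>x. f x \<partial>PiM I M)"
    using fi unfolding J(3) by (rule product_integral_insert[OF J(1,2), symmetric])
  finally show "(\<integral>x. \<integral>y. f (x(k := y)) \<partial>M k \<partial>PiM I M) = (\<integral>x. f x \<partial>PiM I M)" .
qed

lemma (in finite_product_prob_space) measurable_variance_resample:
  fixes f :: "('a \<Rightarrow> 'b) \<Rightarrow> real"
  assumes k: "k \<in> I" and f: "f \<in> borel_measurable (PiM I M)"
  shows "(\<lambda>x. M.variance k (\<lambda>y. f (x(k := y)))) \<in> borel_measurable (PiM I M)"
proof -
  define h where "h = (\<lambda>z. f ((fst z)(k := snd z)))"
  have [measurable]: "h \<in> borel_measurable (PiM I M \<Otimes>\<^sub>M M k)"
    unfolding h_def by (rule measurable_compose[OF measurable_resample[OF k] f])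
  have "(\<lambda>x. M.variance k (\<lambda>y. h (x, y))) \<in> borel_measurable (PiM I M)"
    by measurable
  then show ?thesis by (simp add: h_def)
qed

lemma (in prob_space) variance_bounded_eq:
  fixes f :: "'a \<Rightarrow> real"
  assumes "f \<in> borel_measurable M" and B: "\<And>x. \<bar>f x\<bar> \<le> B"
  shows "variance f = expectation (\<lambda>x. (f x)\<^sup>2) - (expectation f)\<^sup>2"
proof (rule variance_eq)
  show "integrable M f"
    by (rule integrable_const_bound[where B=B]) (use assms in auto)
  have "(f x)\<^sup>2 \<le> B\<^sup>2" for x
    using B[of x] power_mono[of "\<bar>f x\<bar>" B 2] by simp
  then show "integrable M (\<lambda>x. (f x)\<^sup>2)"
    by (intro integrable_const_bound[where B="B\<^sup>2"]) (use assms in auto)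
qed

text \<open>Induction on the index set. Splitting off a coordinate \<open>i\<close>, the law of
  total variance leaves the mean conditional variance in \<open>i\<close> plus the variance of
  \<open>g\<close>, the average of \<open>f\<close> over \<open>i\<close>. The induction hypothesis
  applies to \<open>g\<close>, and convexity of the variance takes the averaging back out.\<close>

theorem efron_stein:
  fixes M :: "'i \<Rightarrow> 'a measure" and f :: "('i \<Rightarrow> 'a) \<Rightarrow> real"
  assumes M: "\<And>i. prob_space (M i)" and "finite I"
    and "f \<in> borel_measurable (PiM I M)" and "\<And>x. \<bar>f x\<bar> \<le> B"
  shows "prob_space.variance (PiM I M) f
           \<le> (\<Sum>k\<in>I. \<integral>x. prob_space.variance (M k) (\<lambda>y. f (x(k := y))) \<partial>PiM I M)"
  using assms(2-)
proof (induction I arbitrary: f rule: finite_induct)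
  \<comment> \<open>The empty product is a one-point space, on which every function has variance
    0.\<close>
  case empty
  interpret prob_space "PiM {} M" by (rule prob_space_PiM) simp
  show ?case
    by (simp add: PiM_empty lebesgue_integral_count_space_finite)
next
  case (insert i I)
  note f = insert.prems(1) and B = insert.prems(2)
  interpret Mi: prob_space "M k" for k by (rule M)
  interpret product_sigma_finite M ..
  interpret S: finite_product_prob_space M I
    by unfold_locales (rule insert.hyps)
  interpret T: finite_product_prob_space M "insert i I"
    by unfold_locales (use insert.hyps in simp)
  interpret Q: pair_prob_space "PiM I M" "M i" ..
  define h where "h z = f ((fst z)(i := snd z))" for z
  have h: "h \<in> borel_measurable (PiM I M \<Otimes>\<^sub>M M i)"
    unfolding h_def by (rule measurable_compose[OF measurable_extend f])
  have hB: "\<bar>h z\<bar> \<le> B" for z unfolding h_def by (rule B)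
  note H = Q.bounded_integrals[OF h hB]
  define g where "g x = (\<integral>y. h (x, y) \<partial>M i)" for x
  have g: "g \<in> borel_measurable (PiM I M)"
    unfolding g_def using H(5) by (rule borel_measurable_integrable)
  have gB: "\<bar>g x\<bar> \<le> B" for x unfolding g_def by (rule H(7))
  have transfer: "(\<integral>x. u x \<partial>PiM (insert i I) M) = (\<integral>x. \<integral>y. u (x(i := y)) \<partial>M i \<partial>PiM I M)"
    if "integrable (PiM (insert i I) M) u" for u :: "_ \<Rightarrow> real"
    by (rule product_integral_insert[OF insert.hyps that])
  have int: "integrable (PiM (insert i I) M) u"
    if "u \<in> borel_measurable (PiM (insert i I) M)" "\<And>x. \<bar>u x\<bar> \<le> C" for u :: "_ \<Rightarrow> real" and C
    by (rule T.integrable_const_bound[where B=C]) (use that in auto)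
  have sqB: "\<bar>(f x)\<^sup>2\<bar> \<le> B\<^sup>2" for x
    using power_mono[OF B[of x], where n=2] by simp
  let ?v = "\<lambda>k x. \<integral>y. (f (x(k := y)) - (\<integral>y. f (x(k := y)) \<partial>M k))\<^sup>2 \<partial>M k"
  have v: "?v k \<in> borel_measurable (PiM (insert i I) M)" "\<And>x. \<bar>?v k x\<bar> \<le> (2*B)\<^sup>2"
    if "k \<in> insert i I" for k
    by (rule T.measurable_variance_resample[OF that f], rule Mi.abs_variance_le, rule B)
  have "T.variance f = Q.P.variance h"
  proof -
    have "T.expectation f = Q.P.expectation h"
      unfolding transfer[of f, OF int[OF f B]] Q.integral_fst'[OF H(1), symmetric] by (simp add: h_def)
    moreover have "T.expectation (\<lambda>x. (f x)\<^sup>2) = Q.P.expectation (\<lambda>z. (h z)\<^sup>2)"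
      unfolding transfer[of "\<lambda>x. (f x)\<^sup>2", OF int[OF borel_measurable_power[OF f] sqB]]
        Q.integral_fst'[OF H(2), symmetric] by (simp add: h_def)
    ultimately show ?thesis
      unfolding T.variance_bounded_eq[OF f B] Q.P.variance_bounded_eq[OF h hB] by simp
  qed
  also have "\<dots> = S.expectation (\<lambda>x. Mi.variance i (\<lambda>y. h (x, y))) + S.variance g"
    unfolding g_def by (rule Q.total_variance[OF h hB])
  also have "S.variance g \<le> (\<Sum>k\<in>I. \<integral>x. Mi.variance k (\<lambda>y. g (x(k := y))) \<partial>PiM I M)"
    by (rule insert.IH[OF g gB])
  \<comment> \<open>Averaging over coordinate \<open>i\<close> before taking the variance in
    \<open>k\<close> can only decrease it. As \<open>i\<close> and \<open>k\<close> differ, the two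
    updates commute.\<close>
  also have "\<dots> \<le> (\<Sum>k\<in>I. T.expectation (?v k))"
  proof (rule sum_mono)
    fix k assume k: "k \<in> I"
    then have ik: "i \<noteq> k" using insert.hyps by auto
    have vh: "(\<lambda>z. ?v k ((fst z)(i := snd z))) \<in> borel_measurable (PiM I M \<Otimes>\<^sub>M M i)"
      by (rule measurable_compose[OF measurable_extend v(1)]) (use k in simp)
    have "(\<integral>x. Mi.variance k (\<lambda>y. g (x(k := y))) \<partial>PiM I M)
        \<le> (\<integral>x. \<integral>z. ?v k (x(i := z)) \<partial>M i \<partial>PiM I M)"
    proof (rule integral_mono)
      show "integrable (PiM I M) (\<lambda>x. Mi.variance k (\<lambda>y. g (x(k := y))))"
        by (rule S.integrable_const_bound[where B="(2 * B)\<^sup>2"])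
          (unfold real_norm_def, intro always_eventually allI Mi.abs_variance_le gB,
            rule S.measurable_variance_resample[OF k g])
      show "integrable (PiM I M) (\<lambda>x. \<integral>z. ?v k (x(i := z)) \<partial>M i)"
        using Q.bounded_integrals(5)[OF vh v(2)] k by simp
      fix x assume x: "x \<in> space (PiM I M)"
      interpret R: pair_prob_space "M k" "M i" ..
      define h' where "h' z = h (x(k := fst z), snd z)" for z
      have h': "h' \<in> borel_measurable (M k \<Otimes>\<^sub>M M i)"
        unfolding h'_def
        by (intro measurable_compose[OF _ h] measurable_Pair measurable_snd
            measurable_compose[OF measurable_fst measurable_resample_component[OF k x]])
      have "Mi.variance k (\<lambda>y. g (x(k := y))) \<le> (\<integral>z. Mi.variance k (\<lambda>y. h' (y, z)) \<partial>M i)"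
        using R.variance_expectation_le[OF h', of B] hB by (simp add: h'_def g_def)
      also have "\<dots> = (\<integral>z. ?v k (x(i := z)) \<partial>M i)"
        using ik by (simp add: h'_def h_def fun_upd_twist)
      finally show "Mi.variance k (\<lambda>y. g (x(k := y))) \<le> (\<integral>z. ?v k (x(i := z)) \<partial>M i)" .
    qed
    also have "\<dots> = T.expectation (?v k)"
      by (rule transfer[of "?v k", symmetric, OF int[OF v]]) (use k in auto)
    finally show "(\<integral>x. Mi.variance k (\<lambda>y. g (x(k := y))) \<partial>PiM I M) \<le> T.expectation (?v k)" .
  qed
  \<comment> \<open>\<open>?v i\<close> overwrites coordinate \<open>i\<close>, hence is constant in
    it and unchanged by integrating over it.\<close>
  also have "S.expectation (\<lambda>x. Mi.variance i (\<lambda>y. h (x, y))) = T.expectation (?v i)"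
    unfolding transfer[of "?v i", OF int[OF v, OF insertI1 insertI1]]
    by (simp add: h_def Mi.prob_space)
  finally show ?case by (simp add: insert.hyps del: fun_upd_apply)
qed

section \<open>The variance bound for an enumerated class on a product space\<close>

text \<open>Because the components are centred and the coordinates independent, the sum bounded by
  \<open>V\<close> is the variance of the \<open>j\<close>-th sum. Indexing the class by naturals
  allows a measurable choice of a near-maximiser.\<close>

lemma (in finite_product_prob_space) variance_SUP_le:
  fixes s :: "nat \<Rightarrow> 'a \<Rightarrow> 'b \<Rightarrow> real" and V :: real
  assumes meas [measurable]: "\<And>j k. k \<in> I \<Longrightarrow> s j k \<in> borel_measurable (M k)"
    and s1: "\<And>j k y. k \<in> I \<Longrightarrow> \<bar>s j k y\<bar> \<le> 1"
    and s0: "\<And>j k. k \<in> I \<Longrightarrow> M.expectation k (s j k) = 0"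
    and V: "\<And>j. (\<Sum>k\<in>I. M.expectation k (\<lambda>y. (s j k y)\<^sup>2)) \<le> V"
  shows "variance (\<lambda>x. SUP j. \<Sum>k\<in>I. s j k (x k))
           \<le> V + 2 * expectation (\<lambda>x. SUP j. \<Sum>k\<in>I. s j k (x k))"
proof -
  define c where "c = real (card I)"
  define L where "L j x = (\<Sum>k\<in>I. s j k (x k))" for j x
  define a where "a k j x = (\<Sum>i\<in>I - {k}. s j i (x i))" for k j x
  define q where "q k j = M.expectation k (\<lambda>y. (s j k y)\<^sup>2)" for k j
  define Z where "Z x = (SUP j. L j x)" for x
  have comp [measurable]: "(\<lambda>x. s j k (x k)) \<in> borel_measurable (PiM I M)" if "k \<in> I" for j k
    by (rule measurable_compose[OF _ meas[OF that]]) (rule measurable_component_singleton[OF that])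
  have L [measurable]: "L j \<in> borel_measurable (PiM I M)" for j
    unfolding L_def by (rule borel_measurable_sum) (rule comp)
  have a [measurable]: "a k j \<in> borel_measurable (PiM I M)" for k j
    unfolding a_def by (rule borel_measurable_sum) (auto intro: comp)
  have sum_bound: "\<bar>\<Sum>i\<in>J. s j i (x i)\<bar> \<le> c" if "J \<subseteq> I" for J j x
  proof -
    have "\<bar>\<Sum>i\<in>J. s j i (x i)\<bar> \<le> (\<Sum>i\<in>J. 1)"
      by (rule order_trans[OF sum_abs sum_mono]) (use that s1 in auto)
    also have "\<dots> \<le> c"
      using card_mono[OF finite_index that] by (simp add: c_def)
    finally show ?thesis .
  qed
  have LB: "\<bar>L j x\<bar> \<le> c" and aB: "\<bar>a k j x\<bar> \<le> c" for j k x
    unfolding L_def a_def by (auto intro!: sum_bound)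
  have bdd: "bdd_above (range (\<lambda>j. L j x))" for x
    using LB by (intro bdd_aboveI[of _ c]) (auto simp: abs_le_iff)
  have Z [measurable]: "Z \<in> borel_measurable (PiM I M)"
    unfolding Z_def by (rule borel_measurable_cSUP) (use bdd in auto)
  have L_le: "L j x \<le> Z x" for j x
    unfolding Z_def by (rule cSUP_upper[OF _ bdd]) simp
  have ZB: "\<bar>Z x\<bar> \<le> c" for x
  proof -
    have "Z x \<le> c" unfolding Z_def using LB by (intro cSUP_least) (auto simp: abs_le_iff)
    then show ?thesis using L_le[of 0 x] LB[of 0 x] by linarith
  qed
  have L_upd: "L j (x(k := y)) = a k j x + s j k y" if "k \<in> I" for j k x y
  proof -
    have "L j (x(k := y)) = s j k y + (\<Sum>i\<in>I - {k}. s j i ((x(k := y)) i))"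
      unfolding L_def by (subst sum.remove[OF finite_index that]) simp
    also have "(\<Sum>i\<in>I - {k}. s j i ((x(k := y)) i)) = a k j x"
      unfolding a_def by (intro sum.cong) auto
    finally show ?thesis by (simp del: fun_upd_apply)
  qed
  have a_upd: "a k j (x(k := y)) = a k j x" for j k x y
    unfolding a_def by (intro sum.cong) auto
  have q: "\<bar>q k j\<bar> \<le> 1" if "k \<in> I" for k j
    unfolding q_def using s1[OF that] by (intro M.abs_expectation_le) (simp add: abs_square_le_1)
  have main: "variance Z \<le> V + (2 + \<epsilon>) * (expectation Z + c * \<epsilon>)" if \<epsilon>: "0 < \<epsilon>" for \<epsilon>
  proof -
    \<comment> \<open>Taking the least admissible index makes the selection measurable; the slack
      \<open>\<epsilon>\<close> guarantees that one exists even if the supremum is not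
      attained.\<close>
    define t where "t x = (LEAST j. Z x - \<epsilon> \<le> L j x)" for x
    have t [measurable]: "t \<in> PiM I M \<rightarrow>\<^sub>M count_space UNIV"
      unfolding t_def
      by (intro measurable_Least pred_def[THEN iffD2] borel_measurable_le borel_measurable_diff
          borel_measurable_const Z L)
    have Z_le: "Z x \<le> L (t x) x + \<epsilon>" for x
    proof -
      have "\<exists>j. Z x - \<epsilon> < L j x"
        using \<epsilon> less_cSUP_iff[OF _ bdd, of "Z x - \<epsilon>" x] by (auto simp: Z_def)
      then have "\<exists>j. Z x - \<epsilon> \<le> L j x" by (auto intro: less_imp_le)
      from LeastI_ex[OF this] show ?thesis by (simp add: t_def)
    qed
    \<comment> \<open>Averaged over a resampled coordinate \<open>k\<close>, this is the
      one-coordinate variance bound; resampling preserves the product law, so that average has the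
      same mean as \<open>r k\<close>.\<close>
    define r where "r k x = q k (t x) + (2 + \<epsilon>) * (Z x - a k (t x) x)" for k x
    have r: "r k \<in> borel_measurable (PiM I M)" for k
      unfolding r_def by measurable
    have rB: "\<bar>r k x\<bar> \<le> 1 + (2 + \<epsilon>) * (2 * c)" if "k \<in> I" for k x
    proof -
      have "\<bar>(2 + \<epsilon>) * (Z x - a k (t x) x)\<bar> \<le> (2 + \<epsilon>) * (2 * c)"
        unfolding abs_mult using \<epsilon> ZB[of x] aB[of k "t x" x] by (intro mult_mono) auto
      then show ?thesis using q[OF that, of "t x"] unfolding r_def by linarith
    qed
    have coord: "(\<integral>x. M.variance k (\<lambda>y. Z (x(k := y))) \<partial>PiM I M) \<le> expectation (r k)"
      if k: "k \<in> I" for k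
    proof -
      have "(\<integral>x. M.variance k (\<lambda>y. Z (x(k := y))) \<partial>PiM I M)
          \<le> (\<integral>x. \<integral>y. r k (x(k := y)) \<partial>M k \<partial>PiM I M)"
      proof (rule integral_mono)
        show "integrable (PiM I M) (\<lambda>x. M.variance k (\<lambda>y. Z (x(k := y))))"
          by (rule integrable_const_bound[where B="(2 * c)\<^sup>2"])
            (unfold real_norm_def, intro always_eventually allI M.abs_variance_le ZB,
              rule measurable_variance_resample[OF k Z])
        show "integrable (PiM I M) (\<lambda>x. \<integral>y. r k (x(k := y)) \<partial>M k)"
          by (rule integral_resample(1)[OF k r rB[OF k]])
        fix x assume x: "x \<in> space (PiM I M)"
        note [measurable] = measurable_resample_component[OF k x]
        have Zk: "(\<lambda>y. Z (x(k := y))) \<in> borel_measurable (M k)" by measurable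
        have Tk: "(\<lambda>y. t (x(k := y))) \<in> M k \<rightarrow>\<^sub>M count_space UNIV" by measurable
        have Ai: "integrable (M k) (\<lambda>y. a k (t (x(k := y))) x)"
          by (rule M.integrable_const_bound[where B=c]) (use aB measurable_compose[OF Tk] in auto)
        have Qi: "integrable (M k) (\<lambda>y. q k (t (x(k := y))))"
          by (rule M.integrable_const_bound[where B=1]) (use q[OF k] measurable_compose[OF Tk] in auto)
        have Zi: "integrable (M k) (\<lambda>y. Z (x(k := y)))"
          by (rule M.integrable_const_bound[where B=c]) (use ZB Zk in auto)
        \<comment> \<open>Here \<open>y\<close> is the free coordinate and
          \<open>t (x(k := y))\<close> the selected index, through which alone the omitted sums
          depend on \<open>y\<close>.\<close>
        have "M.variance k (\<lambda>y. Z (x(k := y))) \<le> (\<integral>y. q k (t (x(k := y))) \<partial>M k)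
          + (2 + \<epsilon>) * ((\<integral>y. Z (x(k := y)) \<partial>M k) - (\<integral>y. a k (t (x(k := y))) x \<partial>M k))"
          unfolding q_def
        proof (rule M.variance_selection_le[where A=c and a="\<lambda>j. a k j x" and b="\<lambda>j. s j k"])
          show "a k j x + s j k y \<le> Z (x(k := y))" for j y
            using L_le[of j "x(k := y)"] by (simp add: L_upd[OF k])
          show "Z (x(k := y)) \<le> a k (t (x(k := y))) x + s (t (x(k := y))) k y + \<epsilon>" for y
            using Z_le[of "x(k := y)"] by (simp add: L_upd[OF k])
        qed (rule meas[OF k] Zk Tk s1[OF k] s0[OF k] aB)+
        also have "\<dots> = (\<integral>y. r k (x(k := y)) \<partial>M k)"
          using Ai Qi Zi by (simp add: r_def a_upd del: fun_upd_apply)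
        finally show "M.variance k (\<lambda>y. Z (x(k := y))) \<le> (\<integral>y. r k (x(k := y)) \<partial>M k)" .
      qed
      also have "\<dots> = expectation (r k)"
        by (rule integral_resample(2)[OF k r rB[OF k]])
      finally show ?thesis .
    qed
    have ri: "integrable (PiM I M) (r k)" if "k \<in> I" for k
      by (rule integrable_const_bound[where B="1 + (2 + \<epsilon>) * (2 * c)"]) (use r rB[OF that] in auto)
    have Zi: "integrable (PiM I M) Z"
      by (rule integrable_const_bound[where B=c]) (use ZB in auto)
    have "variance Z \<le> (\<Sum>k\<in>I. \<integral>x. M.variance k (\<lambda>y. Z (x(k := y))) \<partial>PiM I M)"
      by (rule efron_stein[OF M.prob_space_axioms finite_index Z ZB])
    also have "\<dots> \<le> (\<Sum>k\<in>I. expectation (r k))"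
      by (rule sum_mono) (rule coord)
    also have "\<dots> = expectation (\<lambda>x. \<Sum>k\<in>I. r k x)"
      using ri by simp
    also have "\<dots> \<le> expectation (\<lambda>x. V + (2 + \<epsilon>) * (Z x + c * \<epsilon>))"
    proof (rule integral_mono)
      fix x
      \<comment> \<open>Omitting each coordinate once removes every component of the selected
        element exactly once. The gaps therefore add up to \<open>L (t x) x\<close> plus
        \<open>c\<close> selection errors, so a single \<open>Z x\<close> suffices.\<close>
      have "(\<Sum>k\<in>I. Z x - a k (t x) x) = (\<Sum>k\<in>I. Z x - L (t x) x + s (t x) k (x k))"
      proof (intro sum.cong refl)
        fix k assume "k \<in> I"
        from L_upd[OF this, of "t x" x "x k"]
        show "Z x - a k (t x) x = Z x - L (t x) x + s (t x) k (x k)" by simp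
      qed
      also have "\<dots> = c * (Z x - L (t x) x) + L (t x) x"
        by (simp add: sum.distrib c_def L_def)
      also have "\<dots> \<le> c * \<epsilon> + Z x"
        using Z_le[of x] L_le[of "t x" x] by (intro add_mono mult_left_mono) (auto simp: c_def)
      finally have "(\<Sum>k\<in>I. Z x - a k (t x) x) \<le> c * \<epsilon> + Z x" .
      then have "(2 + \<epsilon>) * (\<Sum>k\<in>I. Z x - a k (t x) x) \<le> (2 + \<epsilon>) * (Z x + c * \<epsilon>)"
        using \<epsilon> by (intro mult_left_mono) auto
      \<comment> \<open>The same index \<open>t x\<close> serves all \<open>k\<close>, so this is
        the variance of one sum and not a sum of suprema.\<close>
      moreover have "(\<Sum>k\<in>I. q k (t x)) \<le> V" unfolding q_def by (rule V)
      ultimately show "(\<Sum>k\<in>I. r k x) \<le> V + (2 + \<epsilon>) * (Z x + c * \<epsilon>)"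
        by (simp add: r_def sum.distrib sum_distrib_left[symmetric])
    qed (use ri Zi in auto)
    also have "\<dots> = V + (2 + \<epsilon>) * (expectation Z + c * \<epsilon>)"
      using Zi by (simp add: P.prob_space)
    finally show ?thesis .
  qed
  have "((\<lambda>\<epsilon>. V + (2 + \<epsilon>) * (expectation Z + c * \<epsilon>)) \<longlongrightarrow> V + 2 * expectation Z) (at_right 0)"
    by (auto intro!: tendsto_eq_intros)
  then have "variance Z \<le> V + 2 * expectation Z"
    by (rule tendsto_lowerbound) (auto intro!: eventually_at_rightI[of 0 1] main)
  then show ?thesis by (simp add: Z_def[abs_def] L_def)
qed

section \<open>Transfer to the given independent random variables\<close>

lemma (in prob_space) indep_vars_variance_sum:
  fixes Y :: "'i \<Rightarrow> 'a \<Rightarrow> real"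
  assumes "finite I" and ind: "indep_vars (\<lambda>_. borel) Y I"
    and i1: "\<And>i. i \<in> I \<Longrightarrow> integrable M (Y i)"
    and i2: "\<And>i. i \<in> I \<Longrightarrow> integrable M (\<lambda>\<omega>. (Y i \<omega>)\<^sup>2)"
    and zero: "\<And>i. i \<in> I \<Longrightarrow> expectation (Y i) = 0"
  shows "variance (\<lambda>\<omega>. \<Sum>i\<in>I. Y i \<omega>) = (\<Sum>i\<in>I. expectation (\<lambda>\<omega>. (Y i \<omega>)\<^sup>2))"
proof -
  have off: "integrable M (\<lambda>\<omega>. Y i \<omega> * Y j \<omega>) \<and> expectation (\<lambda>\<omega>. Y i \<omega> * Y j \<omega>) = 0"
    if "i \<in> I" "j \<in> I" "i \<noteq> j" for i j
  proof -
    have *: "indep_vars (\<lambda>_. borel) Y {i, j}"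
      by (rule indep_vars_subset[OF ind]) (use that in auto)
    have i1': "integrable M (Y k)" if "k \<in> {i, j}" for k
      using i1 that \<open>i \<in> I\<close> \<open>j \<in> I\<close> by auto
    show ?thesis
      using indep_vars_lebesgue_integral[OF _ * i1'] indep_vars_integrable[OF _ * i1'] zero that
      by simp
  qed
  have int: "integrable M (\<lambda>\<omega>. Y i \<omega> * Y j \<omega>)" if "i \<in> I" "j \<in> I" for i j
    using off[OF that] i2[OF that(1)] by (cases "i = j") (auto simp: power2_eq_square)
  have "expectation (\<lambda>\<omega>. \<Sum>i\<in>I. Y i \<omega>) = 0"
    using i1 zero by simp
  then have "variance (\<lambda>\<omega>. \<Sum>i\<in>I. Y i \<omega>) = expectation (\<lambda>\<omega>. \<Sum>i\<in>I. \<Sum>j\<in>I. Y i \<omega> * Y j \<omega>)"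
    by (simp add: power2_eq_square sum_product)
  also have "\<dots> = (\<Sum>i\<in>I. \<Sum>j\<in>I. expectation (\<lambda>\<omega>. Y i \<omega> * Y j \<omega>))"
    using int by simp
  also have "\<dots> = (\<Sum>i\<in>I. \<Sum>j\<in>I. if j = i then expectation (\<lambda>\<omega>. (Y i \<omega>)\<^sup>2) else 0)"
    using off by (intro sum.cong) (auto simp: power2_eq_square)
  finally show ?thesis using \<open>finite I\<close> by simp
qed

theorem corollary1p1:
  fixes M :: "'w measure"
    and n :: nat
    and X :: "nat \<Rightarrow> 'w \<Rightarrow> 'x::polish_space"
    and S :: "(nat \<Rightarrow> 'x \<Rightarrow> real) set"
  assumes "prob_space M"
    and "prob_space.indep_vars M (\<lambda>_. borel) X {1..n}"
    and "S \<noteq> {}" and "countable S"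
    and "\<And>s k. s \<in> S \<Longrightarrow> k \<in> {1..n} \<Longrightarrow> s k \<in> borel_measurable borel"
    and "\<And>s k x. s \<in> S \<Longrightarrow> k \<in> {1..n} \<Longrightarrow> s k x \<in> {-1..1}"
    and "\<And>s k. s \<in> S \<Longrightarrow> k \<in> {1..n} \<Longrightarrow> prob_space.expectation M (\<lambda>\<omega>. s k (X k \<omega>)) = 0"
  shows "prob_space.variance M (class_sup n X S)
           \<le> class_var M n X S + 2 * prob_space.expectation M (class_sup n X S)"
proof (cases "n = 0")
  \<comment> \<open>For \<open>n = 0\<close> both sides vanish. Otherwise the index set is nonempty,
    and independence over it can be expressed by a product law.\<close>
  case True
  then have "class_sum n X s = (\<lambda>_. 0)" for s
    by (simp add: class_sum_def fun_eq_iff)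
  moreover from this have "class_sup n X S = (\<lambda>_. 0)"
    using \<open>S \<noteq> {}\<close> by (simp add: class_sup_def fun_eq_iff)
  ultimately show ?thesis
    using \<open>S \<noteq> {}\<close> by (simp add: class_var_def)
next
  case False
  interpret prob_space M by fact
  define I where "I = {1..n}"
  note ind = assms(2)[folded I_def] and meas = assms(5)[folded I_def] and mean = assms(7)[folded I_def]
  have I: "finite I" "I \<noteq> {}" using False by (auto simp: I_def)
  have s1: "\<bar>s k x\<bar> \<le> 1" if "s \<in> S" "k \<in> I" for s k x
    using assms(6)[OF that[unfolded I_def], of x] by (simp add: abs_le_iff)
  have s2: "(s k x)\<^sup>2 \<le> 1" if "s \<in> S" "k \<in> I" for s k x
    using s1[OF that, of x] by (simp add: abs_square_le_1)
  have X: "X k \<in> borel_measurable M" if "k \<in> I" for k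
    using ind that by (auto simp: indep_vars_def)
  have sX: "(\<lambda>\<omega>. s k (X k \<omega>)) \<in> borel_measurable M" if "s \<in> S" "k \<in> I" for s k
    by (rule measurable_compose[OF X meas]) (use that in auto)
  \<comment> \<open>The Dirac measure outside \<open>I\<close> makes \<open>D k\<close> a
    probability measure for every \<open>k\<close>, as the product construction expects.\<close>
  define D where "D k = (if k \<in> I then distr M borel (X k) else return borel undefined)" for k
  have D: "prob_space (D k)" for k
    unfolding D_def using prob_space_distr[OF X] by (auto intro: prob_space_return)
  interpret D: prob_space "D k" for k by (rule D)
  interpret product_sigma_finite D ..
  interpret P: finite_product_prob_space D I by unfold_locales (rule I)
  define Y where "Y \<omega> = (\<lambda>k\<in>I. X k \<omega>)" for \<omega>
  have Y: "Y \<in> M \<rightarrow>\<^sub>M PiM I (\<lambda>_. borel)"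
    unfolding Y_def by (rule measurable_restrict) (rule X)
  have "distr M (PiM I (\<lambda>_. borel)) Y = PiM I (\<lambda>k. distr M borel (X k))"
    unfolding Y_def by (rule iffD1[OF indep_vars_iff_distr_eq_PiM' ind]) (use I X in auto)
  also have "\<dots> = PiM I D" by (intro PiM_cong) (auto simp: D_def)
  finally have distr: "PiM I D = distr M (PiM I (\<lambda>_. borel)) Y" by simp
  have var_class: "variance (class_sum n X s) = (\<Sum>k\<in>I. expectation (\<lambda>\<omega>. (s k (X k \<omega>))\<^sup>2))"
    if s: "s \<in> S" for s
    unfolding class_sum_def[abs_def] I_def[symmetric]
  proof (rule indep_vars_variance_sum[OF I(1)])
    show "indep_vars (\<lambda>_. borel) (\<lambda>k \<omega>. s k (X k \<omega>)) I"
      by (rule indep_vars_compose2[OF ind]) (rule meas[OF s])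
    show "integrable M (\<lambda>\<omega>. s k (X k \<omega>))" if "k \<in> I" for k
      by (rule integrable_const_bound[where B=1]) (use s1[OF s that] sX[OF s that] in auto)
    show "integrable M (\<lambda>\<omega>. (s k (X k \<omega>))\<^sup>2)" if "k \<in> I" for k
      by (rule integrable_const_bound[where B=1]) (use s2[OF s that] sX[OF s that] in auto)
  qed (rule mean[OF s])
  \<comment> \<open>This uniform bound makes \<open>class_var\<close> a genuine supremum, hence an
    upper bound for each individual variance.\<close>
  have "variance (class_sum n X s) \<le> real (card I)" if s: "s \<in> S" for s
  proof -
    have "variance (class_sum n X s) \<le> (\<Sum>k\<in>I. 1)"
      unfolding var_class[OF s]
      using abs_expectation_le[of "\<lambda>\<omega>. (s _ (X _ \<omega>))\<^sup>2" 1] s2[OF s]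
      by (intro sum_mono) (simp add: abs_le_iff)
    then show ?thesis by simp
  qed
  then have var_le: "variance (class_sum n X s) \<le> class_var M n X S" if "s \<in> S" for s
    unfolding class_var_def using that by (intro cSUP_upper bdd_aboveI2)
  \<comment> \<open>An enumeration that may repeat elements, so finite and infinite classes are
    treated alike.\<close>
  define e where "e = from_nat_into S"
  have eS: "e j \<in> S" for j unfolding e_def by (rule from_nat_into[OF \<open>S \<noteq> {}\<close>])
  have range_e: "S = range e"
    unfolding e_def by (rule range_from_nat_into[OF \<open>S \<noteq> {}\<close> \<open>countable S\<close>, symmetric])
  define Z where "Z x = (SUP j. \<Sum>k\<in>I. e j k (x k))" for x
  have sup_eq: "class_sup n X S \<omega> = Z (Y \<omega>)" for \<omega>
    unfolding class_sup_def range_e Z_def class_sum_def Y_def I_def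
    by (simp add: image_image)
  have Z: "Z \<in> borel_measurable (PiM I (\<lambda>_. borel))"
    unfolding Z_def
  proof (rule borel_measurable_cSUP)
    show "(\<lambda>x. \<Sum>k\<in>I. e j k (x k)) \<in> borel_measurable (PiM I (\<lambda>_. borel))" for j
      by (intro borel_measurable_sum measurable_compose[OF _ meas[OF eS]])
        (rule measurable_component_singleton)
    have "(\<Sum>k\<in>I. e j k (x k)) \<le> (\<Sum>k\<in>I. 1)" for j x
      using s1[OF eS] by (intro sum_mono) (auto simp: abs_le_iff)
    then show "bdd_above (range (\<lambda>j. \<Sum>k\<in>I. e j k (x k)))" for x
      by (intro bdd_aboveI2)
  qed auto
  have D_expectation: "D.expectation k u = expectation (\<lambda>\<omega>. u (X k \<omega>))"
    if "k \<in> I" "u \<in> borel_measurable borel" for k and u :: "'x \<Rightarrow> real"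
    using that X by (simp add: D_def integral_distr)
  have "P.variance Z \<le> class_var M n X S + 2 * P.expectation Z"
    unfolding Z_def
  proof (rule P.variance_SUP_le)
    fix j k assume k: "k \<in> I"
    show "e j k \<in> borel_measurable (D k)" using meas[OF eS k] k by (simp add: D_def)
    show "\<bar>e j k y\<bar> \<le> 1" for y by (rule s1[OF eS k])
    show "D.expectation k (e j k) = 0"
      using D_expectation[OF k meas[OF eS k]] mean[OF eS k] by simp
  next
    fix j
    have "(\<Sum>k\<in>I. D.expectation k (\<lambda>y. (e j k y)\<^sup>2)) = variance (class_sum n X (e j))"
      unfolding var_class[OF eS]
      by (intro sum.cong refl D_expectation borel_measurable_power meas[OF eS])
    also have "\<dots> \<le> class_var M n X S" by (rule var_le[OF eS])
    finally show "(\<Sum>k\<in>I. D.expectation k (\<lambda>y. (e j k y)\<^sup>2)) \<le> class_var M n X S" .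
  qed
  moreover have "P.expectation u = expectation (\<lambda>\<omega>. u (Y \<omega>))"
    if "u \<in> borel_measurable (PiM I (\<lambda>_. borel))" for u :: "_ \<Rightarrow> real"
    unfolding distr by (rule integral_distr[OF Y that])
  ultimately show ?thesis
    using Z by (simp add: sup_eq[abs_def])
qed

end
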